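(* Let $d$ be a positive integer and let $v\in\{0,1\}^d$ with $e_{d-1}\prec v$ (i.e., $P^{\prec v}$ is a full-dimensional revlex-initial 0/1-polytope). Let $D(v):=D_1(v)\cup D_2(v)$ with $$D_1(v):=\begin{cases} S(v) & \text{if } w(v)=2\\ \varnothing & \text{otherwise}\end{cases}\qquad\text{and}\qquad D_2(v):=\begin{cases}\{\sigma_2(v)+1,\dots,d-1\} & \text{if }\sigma_2(v)<d-2\\ \varnothing & \text{otherwise.}\end{cases}$$ (1) The following system is a minimal (with respect to inclusion) linear description of $P^{\prec v}$ by facet defining inequalities: $$\begin{array}{rcll} x_i & \ge & 0 & \text{for all } i\in\{0,\dots,d-1\}\\ x_i & \le & 1 & \text{for all } i\in\{0,\dots,d-1\}\setminus D(v)\\ x_i+\sum_{j\in S^{>i}(v)}x_j & \le & |S^{>i}(v)| & \text{for all } i\in\overline{S}(v),\ i>\sigma_{w(v)}(v)\\ \sum_{j\in S(v)}x_j & \le & w(v)-1.\end{array}$$ (2) The number $f_{d-1}(P^{\prec v})$ of facets of $P^{\prec v}$ is $$f_{d-1}(P^{\prec v})=2d+\big|\{i : \sigma_{w(v)}(v)<i<\sigma_2(v),\ v_i=0\}\big|+\epsilon,$$ where $$\epsilon:=\begin{cases}-1 & \text{if } w(v)=2\\ 0 & \text{if } w(v)>2,\ v_{d-2}=0\\ 1 & \text{if } w(v)>2,\ v_{d-2}=1.\end{cases}$$ We have $2d-1\le f_{d-1}(P^{\prec v})\le 3d-2$. The minimum number $2d-1$ of facets is attained if and only if $w(v)=2$,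 and, for $d\ge 3$, the maximum $f_{d-1}(P^{\prec v})=3d-2$ is achieved only by $v=e_0+e_{d-2}+e_{d-1}$.
   Context: Vectors $x\in\mathbb{R}^d$ have components $x_0,x_1,\dots,x_{d-1}$, and $e_i$ ($0\le i\le d-1$) denotes the $i$-th standard unit vector. For distinct $x,y\in\{0,1\}^d$, $x\prec y$ (reverse-lexicographically smaller) means $x_m<y_m$ for $m=\max\{i: x_i\neq y_i\}$. For $v\in\{0,1\}^d$, $X^{\prec v}:=\{x\in\{0,1\}^d : x\prec v\}$ and $P^{\prec v}:=\operatorname{conv}X^{\prec v}$ (a revlex-initial 0/1-polytope). For $v\in\{0,1\}^d\setminus\{0\}$: $S(v):=\{i\in\{0,\dots,d-1\}: v_i=1\}$, $\overline{S}(v):=\{0,\dots,d-1\}\setminus S(v)$, $w(v):=|S(v)|$, and $\sigma_1(v)>\sigma_2(v)>\dots>\sigma_{w(v)}(v)$ are the elements of $S(v)$ in decreasing order. For an index $i$, $S^{>i}(v):=\{j\in S(v): j>i\}$. *)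

theory Defs
  imports "HOL-Analysis.Analysis"
begin

text \<open>
  Vectors in d-dimensional space are elements of \<open>real ^ 'n\<close> with d = \<open>CARD('n)\<close>. The index type is
  linearly ordered, so that its elements can be numbered 0, ..., d - 1 in increasing order; all
  indices below are such numbers.
\<close>

definition idx :: "nat \<Rightarrow> 'n::{finite,linorder}" where
  "idx i = sorted_list_of_set (UNIV :: 'n set) ! i"

definition coord :: "real ^ 'n::{finite,linorder} \<Rightarrow> nat \<Rightarrow> real" where
  "coord x i = x $ idx i"

definition unit_vec :: "nat \<Rightarrow> real ^ 'n::{finite,linorder}" where
  "unit_vec i = axis (idx i) 1"

definition zero_one :: "(real ^ 'n::{finite,linorder}) set" where
  "zero_one = {x. \<forall>i<CARD('n). coord x i \<in> {0, 1}}"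

definition revlex_less :: "real ^ 'n::{finite,linorder} \<Rightarrow> real ^ 'n::{finite,linorder} \<Rightarrow> bool" where
  "revlex_less x y \<longleftrightarrow> x \<noteq> y \<and>
     (let m = Max {i. i < CARD('n) \<and> coord x i \<noteq> coord y i} in coord x m < coord y m)"

definition revlex_initial :: "real ^ 'n::{finite,linorder} \<Rightarrow> (real ^ 'n::{finite,linorder}) set" where
  "revlex_initial v = {x \<in> zero_one. revlex_less x v}"

definition revlex_polytope :: "real ^ 'n::{finite,linorder} \<Rightarrow> (real ^ 'n::{finite,linorder}) set" where
  "revlex_polytope v = (convex hull revlex_initial v)"

definition S_set :: "real ^ 'n::{finite,linorder} \<Rightarrow> nat set" where
  "S_set v = {i. i < CARD('n) \<and> coord v i = 1}"

definition S_bar :: "real ^ 'n::{finite,linorder} \<Rightarrow> nat set" where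
  "S_bar v = {0..<CARD('n)} - S_set v"

definition S_above :: "nat \<Rightarrow> real ^ 'n::{finite,linorder} \<Rightarrow> nat set" where
  "S_above i v = {j \<in> S_set v. j > i}"

definition weight :: "real ^ 'n::{finite,linorder} \<Rightarrow> nat" where
  "weight v = card (S_set v)"

text \<open>The k-th largest element of \<open>S_set v\<close>, counting from 1; meaningful for k between 1 and \<open>weight v\<close>.\<close>

definition sigma_S :: "nat \<Rightarrow> real ^ 'n::{finite,linorder} \<Rightarrow> nat" where
  "sigma_S k v = rev (sorted_list_of_set (S_set v)) ! (k - 1)"

definition D1 :: "real ^ 'n::{finite,linorder} \<Rightarrow> nat set" where
  "D1 v = (if weight v = 2 then S_set v else {})"

text \<open>
  The natural-number difference \<open>CARD('n) - 2\<close> is not truncated in the cases of interest: \<open>weight v \<ge> 2\<close>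
  forces \<open>CARD('n) \<ge> 2\<close>.
\<close>

definition D2 :: "real ^ 'n::{finite,linorder} \<Rightarrow> nat set" where
  "D2 v = (if sigma_S 2 v < CARD('n) - 2 then {sigma_S 2 v + 1..CARD('n) - 1} else {})"

definition D_set :: "real ^ 'n::{finite,linorder} \<Rightarrow> nat set" where
  "D_set v = D1 v \<union> D2 v"

text \<open>A pair \<open>(a, b)\<close> stands for the linear inequality \<open>a \<bullet> x \<le> b\<close>, a set of pairs for a system.\<close>

definition solutions :: "('a::real_inner \<times> real) set \<Rightarrow> 'a set" where
  "solutions Q = {x. \<forall>(a, b) \<in> Q. a \<bullet> x \<le> b}"

definition minimal_description :: "('a::real_inner \<times> real) set \<Rightarrow> 'a set \<Rightarrow> bool" where
  "minimal_description Q P \<longleftrightarrow> solutions Q = P \<and> (\<forall>R. R \<subset> Q \<longrightarrow> solutions R \<noteq> P)"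

definition facet_defining :: "'a::euclidean_space \<times> real \<Rightarrow> 'a set \<Rightarrow> bool" where
  "facet_defining q P \<longleftrightarrow>
     (case q of (a, b) \<Rightarrow> (\<forall>x\<in>P. a \<bullet> x \<le> b) \<and> {x \<in> P. a \<bullet> x = b} facet_of P)"

text \<open>The nonnegativity constraints \<open>x\<^sub>i \<ge> 0\<close> are written as \<open>- x\<^sub>i \<le> 0\<close>.\<close>

definition revlex_system :: "real ^ 'n::{finite,linorder} \<Rightarrow> ((real ^ 'n::{finite,linorder}) \<times> real) set" where
  "revlex_system v =
     {(- unit_vec i, 0) | i. i \<in> {0..<CARD('n)}} \<union>
     {(unit_vec i, 1) | i. i \<in> {0..<CARD('n)} - D_set v} \<union>
     {(unit_vec i + (\<Sum>j\<in>S_above i v. unit_vec j), real (card (S_above i v))) | i.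
        i \<in> S_bar v \<and> i > sigma_S (weight v) v} \<union>
     {(\<Sum>j\<in>S_set v. unit_vec j, real (weight v) - 1)}"

definition num_facets :: "'a::euclidean_space set \<Rightarrow> nat" where
  "num_facets P = card {F. F facet_of P}"

definition eps :: "real ^ 'n::{finite,linorder} \<Rightarrow> int" where
  "eps v = (if weight v = 2 then -1 else if coord v (CARD('n) - 2) = 0 then 0 else 1)"

end

theory Submission
  imports Defs
begin

text \<open>
  Membership in the polytope is best read off the zeros of a 0/1-point \<open>x\<close> inside \<open>S = S(v)\<close>. The point
  is revlex-smaller than \<open>v\<close> iff some position of \<open>S\<close> carries a zero and every one at a position
  \<open>i \<notin> S\<close> has a zero at a position of \<open>S\<close> above it. With the deficit
  \<open>y\<^sub>k(x) = \<Sum>{1 - x\<^sub>j | j \<in> S, j \<ge> k}\<close> these two conditions become the inequalities \<open>1 \<le> y\<^sub>0\<close> and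
  \<open>x\<^sub>i \<le> y\<^bsub>i+1\<^esub>\<close>, which are exactly the two non-trivial kinds of inequality in the system
  (lemma \<open>revlex_less_iff_deficit\<close>). For \<open>i\<close> below \<open>min S\<close> the second condition follows from the first.

  The system has no further vertices because it can be rounded at random. Pick \<open>\<theta>\<close> uniformly in
  \<open>[0,1)\<close> and replace each \<open>x\<^sub>i\<close> with \<open>i \<notin> S\<close> and each deficit \<open>y\<^sub>k\<close> by \<open>\<lceil>x\<^sub>i - \<theta>\<rceil>\<close> and \<open>\<lceil>y\<^sub>k - \<theta>\<rceil>\<close>. Consecutive
  deficits differ by at most one, so this gives a 0/1-point; rounding with a common \<open>\<theta>\<close> is monotone,
  so the point still satisfies the system and lies below \<open>v\<close>; and \<open>\<lceil>c - \<theta>\<rceil>\<close> has mean \<open>c\<close>, so the mean of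
  the random point is \<open>x\<close>. Hence every solution \<open>x\<close> is a mean of points of the closed convex set
  \<open>P\<close> and belongs to it (\<open>solutions_eq\<close>). The upper bounds omitted for the indices in \<open>D(v)\<close> are
  consequences of nonnegativity and of inequalities \<open>x\<^sub>i + x\<^bsub>d-1\<^esub> \<le> 1\<close>, where \<open>i \<noteq> d - 1\<close>
  (\<open>slack_imp_le_1\<close>).

  No inequality can be dropped: each has a point violating it and no other (\<open>slack_witness\<close>). Together
  with a point strictly inside, such witnesses make the system minimal, all its inequalities facet
  defining, and the facets equinumerous with the inequalities (\<open>irredundant_system\<close>). The number of
  facets and its extreme values are then a matter of counting indices.
\<close>

section \<open>Irredundant linear systems\<close>

lemma segment_hits_one_boundary:
  fixes a :: "'i \<Rightarrow> 'a::real_inner"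
  assumes "i \<in> I" and inner: "\<And>k. k \<in> I \<Longrightarrow> a k \<bullet> y < b k"
    and out: "b i < a i \<bullet> z" and others: "\<And>k. k \<in> I \<Longrightarrow> k \<noteq> i \<Longrightarrow> a k \<bullet> z \<le> b k"
  obtains x where "a i \<bullet> x = b i" and "\<And>k. k \<in> I \<Longrightarrow> k \<noteq> i \<Longrightarrow> a k \<bullet> x < b k"
proof -
  define p where "p = b i - a i \<bullet> y"
  define r where "r = a i \<bullet> z - b i"
  have pr: "p > 0" "r > 0" using inner[OF \<open>i \<in> I\<close>] out by (auto simp: p_def r_def)
  \<comment> \<open>The weights are inversely proportional to the distances \<open>p\<close> and \<open>r\<close> from the hyperplane.\<close>
  define x where "x = (r / (p + r)) *\<^sub>R y + (p / (p + r)) *\<^sub>R z"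
  have eq: "a k \<bullet> x = (r * (a k \<bullet> y) + p * (a k \<bullet> z)) / (p + r)" for k
    by (simp add: x_def inner_add_right add_divide_distrib)
  have "r * (a i \<bullet> y) + p * (a i \<bullet> z) = b i * (p + r)"
    by (simp add: p_def r_def algebra_simps)
  then have "a i \<bullet> x = b i" using pr by (simp add: eq)
  moreover have "a k \<bullet> x < b k" if "k \<in> I" "k \<noteq> i" for k
  proof -
    have "r * (a k \<bullet> y) < r * b k" "p * (a k \<bullet> z) \<le> p * b k"
      using inner[OF that(1)] others[OF that] pr by auto
    then have "r * (a k \<bullet> y) + p * (a k \<bullet> z) < b k * (p + r)" by (simp add: algebra_simps)
    then show ?thesis using pr by (simp add: eq divide_less_eq)
  qed
  ultimately show ?thesis using that by blast
qed

text \<open>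
  The point \<open>y\<close> makes the polyhedron full-dimensional, so the facets are the faces cut out by the
  single inequalities. Different inequalities give different facets: where the segment from \<open>y\<close>
  to \<open>z i\<close> meets the hyperplane of inequality \<open>i\<close>, all the others are strict. The family is indexed rather than
  a set of pairs because the witnesses then also show that its members are pairwise different.
\<close>

lemma irredundant_system:
  fixes a :: "'i \<Rightarrow> 'a::euclidean_space" and b :: "'i \<Rightarrow> real" and I :: "'i set"
  defines "Q \<equiv> (\<lambda>i. (a i, b i)) ` I"
  assumes fin: "finite I" and inner: "\<And>i. i \<in> I \<Longrightarrow> a i \<bullet> y < b i"
    and out: "\<And>i. i \<in> I \<Longrightarrow> b i < a i \<bullet> z i"
    and others: "\<And>i k. i \<in> I \<Longrightarrow> k \<in> I \<Longrightarrow> k \<noteq> i \<Longrightarrow> a k \<bullet> z i \<le> b k"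
  shows "aff_dim (solutions Q) = DIM('a)" (is ?dim)
    and "minimal_description Q (solutions Q)" (is ?min)
    and "\<forall>q\<in>Q. facet_defining q (solutions Q)" (is ?facets)
    and "num_facets (solutions Q) = card I" (is ?count)
proof -
  define P where "P = solutions Q"
  define H where "H i = {x. a i \<bullet> x \<le> b i}" for i
  have P_iff: "x \<in> P \<longleftrightarrow> (\<forall>i\<in>I. a i \<bullet> x \<le> b i)" for x
    by (auto simp: P_def solutions_def Q_def)
  have z_notin: "z i \<notin> H i" and z_in: "k \<in> I \<Longrightarrow> k \<noteq> i \<Longrightarrow> z i \<in> H k" if "i \<in> I" for i k
    using out[OF that] others[OF that, of k] by (auto simp: H_def)
  have inj: "inj_on H I" using z_notin z_in by (metis inj_onI)

  have "open (\<Inter>i\<in>I. {x. a i \<bullet> x < b i})"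
    using fin by (intro open_INT) (auto intro: open_halfspace_lt)
  then have "y \<in> interior P"
    by (rule interiorI) (use inner in \<open>force simp: P_iff less_eq_real_def\<close>)+
  then have ne: "interior P \<noteq> {}" by auto
  then show ?dim unfolding P_def[symmetric] by (rule aff_dim_nonempty_interior)
  have aff: "affine hull P = UNIV" using ne by (rule affine_hull_nonempty_interior)

  show ?min unfolding minimal_description_def
  proof (intro conjI allI impI refl)
    fix R assume R: "R \<subset> Q"
    then obtain i where i: "i \<in> I" "(a i, b i) \<notin> R" by (auto simp: Q_def)
    have "z i \<in> solutions R"
      unfolding solutions_def
    proof (clarify)
      fix c e assume ce: "(c, e) \<in> R"
      then obtain k where "k \<in> I" "c = a k" "e = b k" using R by (auto simp: Q_def)
      then show "c \<bullet> z i \<le> e" using others[OF i(1)] i ce by metis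
    qed
    moreover have "z i \<notin> P" using out i(1) by (force simp: P_iff)
    ultimately show "solutions R \<noteq> solutions Q" unfolding P_def by auto
  qed

  have facet_iff: "C facet_of P \<longleftrightarrow> (\<exists>i\<in>I. C = {x\<in>P. a i \<bullet> x = b i})" for C
  proof -
    define g where "g = inv_into I H"
    have gH: "g (H i) = i" if "i \<in> I" for i using inj that by (simp add: g_def)
    have "C facet_of P \<longleftrightarrow> (\<exists>h. h \<in> H ` I \<and> C = P \<inter> {x. a (g h) \<bullet> x = b (g h)})"
    proof (rule facet_of_polyhedron_explicit)
      show "finite (H ` I)" using fin by simp
      show "P = affine hull P \<inter> \<Inter> (H ` I)" by (auto simp: aff P_iff H_def)
    next
      fix h assume "h \<in> H ` I"
      then obtain i where i: "i \<in> I" "h = H i" by auto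
      have "a i \<noteq> 0" using inner[OF i(1)] out[OF i(1)] by auto
      then show "a (g h) \<noteq> 0 \<and> h = {x. a (g h) \<bullet> x \<le> b (g h)}"
        using i by (simp add: gH) (simp add: H_def)
    next
      fix F' assume F': "F' \<subset> H ` I"
      then obtain i where i: "i \<in> I" "H i \<notin> F'" by auto
      have "z i \<in> \<Inter> F'" using F' i z_in[OF i(1)] by blast
      moreover have "z i \<notin> P" using out i(1) by (force simp: P_iff)
      moreover have "P \<subseteq> \<Inter> F'" using F' by (force simp: P_iff H_def)
      ultimately show "P \<subset> affine hull P \<inter> \<Inter> F'" by (auto simp: aff)
    qed
    then show ?thesis by (auto simp: gH)
  qed
  show ?facets
    unfolding P_def[symmetric]
  proof
    fix q assume "q \<in> Q"
    then obtain i where i: "i \<in> I" "q = (a i, b i)" by (auto simp: Q_def)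
    have "{x\<in>P. a i \<bullet> x = b i} facet_of P" using facet_iff i(1) by blast
    moreover have "\<forall>x\<in>P. a i \<bullet> x \<le> b i" using i(1) P_iff by blast
    ultimately show "facet_defining q P" by (simp add: facet_defining_def i(2))
  qed

  have "inj_on (\<lambda>i. {x\<in>P. a i \<bullet> x = b i}) I"
  proof (rule inj_onI, rule ccontr)
    fix i k assume ik: "i \<in> I" "k \<in> I" "i \<noteq> k"
      and eq: "{x\<in>P. a i \<bullet> x = b i} = {x\<in>P. a k \<bullet> x = b k}"
    obtain x where x: "a i \<bullet> x = b i" "\<And>k. k \<in> I \<Longrightarrow> k \<noteq> i \<Longrightarrow> a k \<bullet> x < b k"
    proof (rule segment_hits_one_boundary[of i I a y b "z i"])
      show "a k \<bullet> y < b k" if "k \<in> I" for k using inner[OF that] .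
      show "a k \<bullet> z i \<le> b k" if "k \<in> I" "k \<noteq> i" for k using others[OF ik(1) that] .
    qed (use ik(1) out in auto)
    have "x \<in> P" unfolding P_iff using x by (metis less_eq_real_def)
    then have "a k \<bullet> x = b k" using eq x(1) by blast
    then show False using x(2)[OF ik(2)] ik(3) by auto
  qed
  moreover have "{F. F facet_of P} = (\<lambda>i. {x\<in>P. a i \<bullet> x = b i}) ` I"
    using facet_iff by auto
  ultimately show ?count
    unfolding num_facets_def P_def[symmetric] by (simp add: card_image)
qed

section \<open>Coordinates\<close>

lemma bij_betw_idx: "bij_betw (idx :: nat \<Rightarrow> 'n) {..<CARD('n)} (UNIV :: 'n::{finite,linorder} set)"
proof -
  have "(idx :: nat \<Rightarrow> 'n) = (!) (sorted_list_of_set (UNIV :: 'n set))"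
    by (rule ext) (simp add: idx_def)
  moreover have "bij_betw ((!) (sorted_list_of_set (UNIV :: 'n set))) {..<CARD('n)} UNIV"
    by (rule bij_betw_nth) auto
  ultimately show ?thesis by simp
qed

lemma idx_eq_iff [simp]:
  "i < CARD('n) \<Longrightarrow> j < CARD('n) \<Longrightarrow> (idx i :: 'n::{finite,linorder}) = idx j \<longleftrightarrow> i = j"
  using bij_betw_imp_inj_on[OF bij_betw_idx] by (auto dest: inj_onD)

lemma vec_eq_coordI:
  fixes x y :: "real ^ 'n::{finite,linorder}"
  assumes "\<And>i. i < CARD('n) \<Longrightarrow> coord x i = coord y i"
  shows "x = y"
proof (rule vec_eq_iff[THEN iffD2], rule allI)
  fix k :: 'n
  obtain i where "i < CARD('n)" "k = idx i"
    using bij_betw_idx[where 'n = 'n] by (auto simp: bij_betw_def)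
  then show "x $ k = y $ k" using assms by (simp add: coord_def)
qed

lemma inner_unit_vec [simp]: "unit_vec i \<bullet> x = coord x i"
  by (simp add: unit_vec_def coord_def inner_axis')

lemma inner_eq_sum_coord:
  fixes x y :: "real ^ 'n::{finite,linorder}"
  shows "x \<bullet> y = (\<Sum>i<CARD('n). coord x i * coord y i)"
  unfolding inner_vec_def coord_def
  by (simp add: sum.reindex_bij_betw[OF bij_betw_idx, where g = "\<lambda>k. x $ k * y $ k"])

lemma coord_simps [simp]:
  "coord (x + y) i = coord x i + coord y i" "coord (- x) i = - coord x i"
  "coord (c *\<^sub>R x) i = c * coord x i"
  by (simp_all add: coord_def)

lemma coord_sum [simp]: "coord (\<Sum>j\<in>A. f j) i = (\<Sum>j\<in>A. coord (f j) i)"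
  by (simp add: coord_def)

lemma coord_unit_vec [simp]:
  "i < CARD('n) \<Longrightarrow> j < CARD('n) \<Longrightarrow>
    coord (unit_vec j :: real ^ 'n::{finite,linorder}) i = (if i = j then 1 else 0)"
  by (simp add: unit_vec_def coord_def axis_def)

definition vec_of :: "(nat \<Rightarrow> real) \<Rightarrow> real ^ 'n::{finite,linorder}" where
  "vec_of f = (\<Sum>i<CARD('n). f i *\<^sub>R unit_vec i)"

lemma coord_vec_of [simp]:
  assumes "i < CARD('n::{finite,linorder})"
  shows "coord (vec_of f :: real ^ 'n::{finite,linorder}) i = f i"
proof -
  have "coord (vec_of f :: real ^ 'n::{finite,linorder}) i = (\<Sum>j<CARD('n). if j = i then f j else 0)"
    unfolding vec_of_def coord_sum using assms by (intro sum.cong) auto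
  then show ?thesis using assms by simp
qed

lemma zero_oneD:
  fixes x :: "real ^ 'n::{finite,linorder}"
  assumes "x \<in> zero_one" "i < CARD('n::{finite,linorder})"
  shows "coord x i = 0 \<or> coord x i = 1"
  using assms by (auto simp: zero_one_def)

lemma revlex_less_iff:
  fixes x y :: "real ^ 'n::{finite,linorder}"
  shows "revlex_less x y \<longleftrightarrow>
    (\<exists>m<CARD('n). coord x m < coord y m \<and> (\<forall>i. m < i \<and> i < CARD('n) \<longrightarrow> coord x i = coord y i))"
    (is "_ \<longleftrightarrow> ?R")
proof -
  define A where "A = {i. i < CARD('n) \<and> coord x i \<noteq> coord y i}"
  have fin: "finite A" by (simp add: A_def)
  have def_eq: "revlex_less x y \<longleftrightarrow> x \<noteq> y \<and> coord x (Max A) < coord y (Max A)"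
    by (simp add: revlex_less_def A_def Let_def)
  show ?thesis
  proof
    assume less: "revlex_less x y"
    have "A \<noteq> {}"
    proof
      assume "A = {}"
      then have "x = y" by (intro vec_eq_coordI) (auto simp: A_def)
      then show False using less def_eq by simp
    qed
    then have "Max A \<in> A" using fin by simp
    then have "Max A < CARD('n)" by (simp add: A_def)
    moreover have "coord x i = coord y i" if "Max A < i \<and> i < CARD('n)" for i
    proof (rule ccontr)
      assume "coord x i \<noteq> coord y i"
      then have "i \<in> A" using that by (simp add: A_def)
      then show False using Max_ge[OF fin, of i] that by simp
    qed
    ultimately show ?R using less def_eq by blast
  next
    assume ?R
    then obtain m where m: "m < CARD('n)" "coord x m < coord y m"
      "\<forall>i. m < i \<and> i < CARD('n) \<longrightarrow> coord x i = coord y i" by blast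
    have "Max A = m"
    proof (rule Max_eqI[OF fin])
      show "i \<le> m" if "i \<in> A" for i using that m(3) unfolding A_def by (metis (mono_tags, lifting) mem_Collect_eq not_less)
      show "m \<in> A" using m by (simp add: A_def)
    qed
    then show "revlex_less x y" using m(2) def_eq by auto
  qed
qed

section \<open>Entries of a decreasingly sorted list\<close>

lemma rev_sorted_list_of_set_nth_last:
  fixes A :: "nat set"
  assumes "finite A" "A \<noteq> {}"
  shows "rev (sorted_list_of_set A) ! (card A - 1) = Min A"
proof -
  have "card A > 0" using assms by (simp add: card_gt_0_iff)
  then show ?thesis using assms
    by (simp add: rev_nth) (simp add: sorted_list_of_set_nonempty)
qed

lemma rev_sorted_list_of_set_nth_1:
  fixes A :: "nat set"
  assumes "finite A" "m \<in> A" "\<And>j. j \<in> A \<Longrightarrow> j \<le> m" "2 \<le> card A"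
  shows "rev (sorted_list_of_set A) ! 1 = Max (A - {m})"
proof -
  define B where "B = A - {m}"
  have B: "finite B" "B \<noteq> {}" using assms unfolding B_def
    by (auto simp: subset_singleton_iff)
  define C where "C = B - {Max B}"
  have sB: "sorted_list_of_set B = sorted_list_of_set C @ [Max B]"
  proof (rule sorted_distinct_set_unique)
    show "sorted (sorted_list_of_set C @ [Max B])"
      using B by (auto simp: sorted_append C_def)
    show "set (sorted_list_of_set B) = set (sorted_list_of_set C @ [Max B])"
      using B(1) Max_in[OF B] by (simp add: C_def insert_absorb)
  qed (use B in \<open>auto simp: C_def\<close>)
  have "sorted_list_of_set A = sorted_list_of_set B @ [m]"
  proof (rule sorted_distinct_set_unique)
    show "sorted (sorted_list_of_set B @ [m])"
      using B assms by (auto simp: sorted_append B_def)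
    show "set (sorted_list_of_set A) = set (sorted_list_of_set B @ [m])"
      using B assms by (auto simp: B_def)
  qed (use B assms in \<open>auto simp: B_def\<close>)
  then show ?thesis by (simp add: sB) (simp add: B_def)
qed

section \<open>Means over the unit interval\<close>

text \<open>
  With \<open>c = n + r\<close>, \<open>n\<close> integral and \<open>0 \<le> r < 1\<close>, the integrand is \<open>n + 1\<close> up to \<open>r\<close> and \<open>n\<close> from there on.
\<close>

lemma ceiling_shift_has_integral:
  fixes c :: real
  shows "((\<lambda>\<theta>. real_of_int \<lceil>c - \<theta>\<rceil>) has_integral c) {0..1}"
proof -
  define n where "n = \<lfloor>c\<rfloor>"
  define r where "r = c - n"
  have r: "0 \<le> r" "r < 1" unfolding r_def n_def by linarith+
  have "((\<lambda>\<theta>. real_of_int \<lceil>c - \<theta>\<rceil>) has_integral (r - 0) *\<^sub>R real_of_int (n + 1)) {0..r}"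
  proof (rule has_integral_spike_finite[of "{r}"])
    fix \<theta> assume "\<theta> \<in> {0..r} - {r}"
    then have "\<lceil>c - \<theta>\<rceil> = n + 1" using r by (simp add: ceiling_eq_iff r_def)
    then show "real_of_int \<lceil>c - \<theta>\<rceil> = real_of_int (n + 1)" by simp
  qed (use has_integral_const_real[of "real_of_int (n + 1)" 0 r] r in simp_all)
  moreover have "((\<lambda>\<theta>. real_of_int \<lceil>c - \<theta>\<rceil>) has_integral (1 - r) *\<^sub>R real_of_int n) {r..1}"
  proof (rule has_integral_spike_finite[of "{1}"])
    fix \<theta> assume "\<theta> \<in> {r..1} - {1}"
    then have "\<lceil>c - \<theta>\<rceil> = n" using r by (simp add: ceiling_eq_iff r_def)
    then show "real_of_int \<lceil>c - \<theta>\<rceil> = real_of_int n" by simp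
  qed (use has_integral_const_real[of "real_of_int n" r 1] r in simp_all)
  ultimately have "((\<lambda>\<theta>. real_of_int \<lceil>c - \<theta>\<rceil>) has_integral
      (r - 0) *\<^sub>R real_of_int (n + 1) + (1 - r) *\<^sub>R real_of_int n) {0..1}"
    using r by (intro has_integral_combine[of 0 r 1]) auto
  then show ?thesis by (simp add: r_def algebra_simps)
qed

text \<open>
  Integrating the inequality of a hyperplane that strictly separates \<open>x\<close> from \<open>C\<close> would give a
  contradiction. The value at 1 is left free because rounding with \<open>\<theta> = 1\<close> turns 0 into -1.
\<close>

lemma mean_in_closed_convex:
  fixes f :: "real \<Rightarrow> 'a::euclidean_space"
  assumes "closed C" "convex C"
    and f_in: "\<And>\<theta>. 0 \<le> \<theta> \<Longrightarrow> \<theta> < 1 \<Longrightarrow> f \<theta> \<in> C"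
    and int: "\<And>a. ((\<lambda>\<theta>. a \<bullet> f \<theta>) has_integral a \<bullet> x) {0..1}"
  shows "x \<in> C"
proof (rule ccontr)
  assume "x \<notin> C"
  then obtain a b where ab: "a \<bullet> x < b" "\<And>y. y \<in> C \<Longrightarrow> b < a \<bullet> y"
    using separating_hyperplane_closed_point[OF assms(2,1)] by blast
  have const: "((\<lambda>\<theta>::real. if \<theta> = 1 then a \<bullet> f 1 else b) has_integral b) {0..1}"
  proof (rule has_integral_spike_finite)
    show "finite {1::real}" by simp
    show "(if \<theta> = 1 then a \<bullet> f 1 else b) = b" if "\<theta> \<in> {0..1} - {1}" for \<theta> :: real
      using that by simp
    show "((\<lambda>\<theta>. b) has_integral b) {0..1::real}"
      using has_integral_const_real[of b 0 1] by simp
  qed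
  have "b \<le> a \<bullet> x"
  proof (rule has_integral_le[OF const int[of a]])
    fix \<theta> :: real assume "\<theta> \<in> {0..1}"
    then show "(if \<theta> = 1 then a \<bullet> f 1 else b) \<le> a \<bullet> f \<theta>"
      using ab(2)[OF f_in[of \<theta>]] by (cases "\<theta> = 1") simp_all
  qed
  then show False using ab(1) by simp
qed

section \<open>The inequalities in terms of deficits\<close>

text \<open>
  Names for the four families of inequalities: the bounds on single coordinates, the inequality
  attached to an index outside \<open>S(v)\<close>, and the one that excludes \<open>v\<close> itself.
\<close>

datatype ineq = Lower nat | Upper nat | Lifted nat | Cover

fun normal :: "real ^ 'n::{finite,linorder} \<Rightarrow> ineq \<Rightarrow> real ^ 'n::{finite,linorder}" where
  "normal v (Lower i) = - unit_vec i"
| "normal v (Upper i) = unit_vec i"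
| "normal v (Lifted i) = unit_vec i + (\<Sum>j\<in>S_above i v. unit_vec j)"
| "normal v Cover = (\<Sum>j\<in>S_set v. unit_vec j)"

fun rhs :: "real ^ 'n::{finite,linorder} \<Rightarrow> ineq \<Rightarrow> real" where
  "rhs v (Lower i) = 0"
| "rhs v (Upper i) = 1"
| "rhs v (Lifted i) = real (card (S_above i v))"
| "rhs v Cover = real (weight v) - 1"

definition ineqs :: "real ^ 'n::{finite,linorder} \<Rightarrow> ineq set" where
  "ineqs v = Lower ` {..<CARD('n)} \<union> Upper ` ({..<CARD('n)} - D_set v) \<union>
     Lifted ` {i \<in> S_bar v. sigma_S (weight v) v < i} \<union> {Cover}"

lemma revlex_system_eq:
  fixes v :: "real ^ 'n::{finite,linorder}"
  shows "revlex_system v = (\<lambda>q. (normal v q, rhs v q)) ` ineqs v"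
proof -
  have family: "{g i | i. P i} = g ` {i. P i}" for g :: "nat \<Rightarrow> (real ^ 'n::{finite,linorder}) \<times> real" and P
    by auto
  show ?thesis
    unfolding revlex_system_def ineqs_def family image_Un image_image
    by (simp only: image_insert image_empty normal.simps rhs.simps lessThan_atLeast0
      Collect_mem_eq)
qed

text \<open>
  For a 0/1-point this is the number of zeros at the positions of \<open>S(v)\<close> from \<open>k\<close> upwards.
\<close>

definition deficit :: "real ^ 'n::{finite,linorder} \<Rightarrow> real ^ 'n::{finite,linorder} \<Rightarrow> nat \<Rightarrow> real" where
  "deficit v x k = (\<Sum>j\<in>{j \<in> S_set v. k \<le> j}. 1 - coord x j)"

fun slack :: "real ^ 'n::{finite,linorder} \<Rightarrow> ineq \<Rightarrow> real ^ 'n::{finite,linorder} \<Rightarrow> real" where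
  "slack v (Lower i) x = coord x i"
| "slack v (Upper i) x = 1 - coord x i"
| "slack v (Lifted i) x = deficit v x (Suc i) - coord x i"
| "slack v Cover x = deficit v x 0 - 1"

lemma finite_S_set [simp]: "finite (S_set v)"
  by (simp add: S_set_def)

lemma slack_eq: "slack v q x = rhs v q - normal v q \<bullet> x"
  by (cases q)
    (simp_all add: deficit_def S_above_def Suc_le_eq weight_def inner_add_left inner_sum_left
      sum_subtractf)

lemma in_solutions_iff: "x \<in> solutions (revlex_system v) \<longleftrightarrow> (\<forall>q\<in>ineqs v. 0 \<le> slack v q x)"
  unfolding revlex_system_eq solutions_def slack_eq by auto

text \<open>
  In this locale \<open>s\<close> and \<open>t\<close> stand for the smallest and the second largest element of \<open>S(v)\<close>; the
  largest one is \<open>d - 1\<close>, where \<open>d\<close> is the dimension.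
\<close>

locale revlex_full =
  fixes v :: "real ^ 'n::{finite,linorder}"
  assumes v01: "v \<in> zero_one"
    and v_large: "revlex_less (unit_vec (CARD('n) - 1)) v"
begin

abbreviation "S \<equiv> S_set v"
abbreviation "s \<equiv> sigma_S (weight v) v"
abbreviation "t \<equiv> sigma_S 2 v"

lemma S_less: "j \<in> S \<Longrightarrow> j < CARD('n)"
  by (simp add: S_set_def)

lemma coord_v: "i < CARD('n) \<Longrightarrow> coord v i = (if i \<in> S then 1 else 0)"
  using zero_oneD[OF v01] by (auto simp: S_set_def)

lemma top_and_second: "CARD('n) - 1 \<in> S" "\<exists>m\<in>S. m < CARD('n) - 1"
proof -
  obtain m where m: "m < CARD('n)" "coord (unit_vec (CARD('n) - 1) :: real ^ 'n::{finite,linorder}) m < coord v m"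
    "\<forall>i. m < i \<and> i < CARD('n) \<longrightarrow> coord (unit_vec (CARD('n) - 1) :: real ^ 'n::{finite,linorder}) i = coord v i"
    using v_large unfolding revlex_less_iff by blast
  have "m \<noteq> CARD('n) - 1" using m(1,2) coord_v[of m] by (auto split: if_splits)
  then have lt: "m < CARD('n) - 1" using m(1) by simp
  then have "coord v (CARD('n) - 1) = 1" using m(3)[rule_format, of "CARD('n) - 1"] by simp
  then show "CARD('n) - 1 \<in> S" by (simp add: S_set_def)
  have "m \<in> S" using m(1,2) lt coord_v[of m] by (auto split: if_splits)
  then show "\<exists>m\<in>S. m < CARD('n) - 1" using lt by blast
qed

lemma weight_ge_2: "2 \<le> weight v"
proof -
  obtain m where m: "m \<in> S" "m < CARD('n) - 1" using top_and_second(2) by blast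
  have "card {m, CARD('n) - 1} \<le> card S" using m top_and_second(1) by (intro card_mono) auto
  then show ?thesis using m by (simp add: weight_def)
qed

lemma s_is_least: "s \<in> S" "j \<in> S \<Longrightarrow> s \<le> j"
proof -
  have "S \<noteq> {}" using top_and_second(1) by auto
  then have "s = Min S"
    unfolding sigma_S_def weight_def by (rule rev_sorted_list_of_set_nth_last[OF finite_S_set])
  then show "s \<in> S" "j \<in> S \<Longrightarrow> s \<le> j" using \<open>S \<noteq> {}\<close> by simp_all
qed

lemma t_is_second_largest: "t \<in> S" "t < CARD('n) - 1" "j \<in> S \<Longrightarrow> j \<le> t \<or> j = CARD('n) - 1"
proof -
  have le: "j \<le> CARD('n) - 1" if "j \<in> S" for j using S_less[OF that] by simp
  have t: "t = Max (S - {CARD('n) - 1})"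
    using rev_sorted_list_of_set_nth_1[OF finite_S_set top_and_second(1) le] weight_ge_2
    by (simp add: sigma_S_def weight_def)
  have "S - {CARD('n) - 1} \<noteq> {}" using top_and_second(2) by auto
  then have "t \<in> S - {CARD('n) - 1}" unfolding t by (intro Max_in) auto
  then show "t \<in> S" "t < CARD('n) - 1" using le[of t] by auto
  show "j \<le> t \<or> j = CARD('n) - 1" if "j \<in> S"
    using that Max_ge[of "S - {CARD('n) - 1}" j] unfolding t by auto
qed

lemma s_le_t: "s \<le> t"
  using s_is_least t_is_second_largest by blast

lemma weight_2_imp:
  assumes "weight v = 2"
  shows "S = {t, CARD('n) - 1}"
proof (rule card_subset_eq[symmetric])
  show "{t, CARD('n) - 1} \<subseteq> S" using t_is_second_largest(1) top_and_second(1) by simp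
  show "card {t, CARD('n) - 1} = card S" using assms t_is_second_largest(2) by (simp add: weight_def)
qed simp

lemma deficit_Suc: "deficit v x k = (if k \<in> S then 1 - coord x k else 0) + deficit v x (Suc k)"
proof (cases "k \<in> S")
  case True
  then have "{j \<in> S. k \<le> j} = insert k {j \<in> S. Suc k \<le> j}" by auto
  then show ?thesis using True by (simp add: deficit_def)
next
  case False
  then have "{j \<in> S. k \<le> j} = {j \<in> S. Suc k \<le> j}" by (auto simp: le_less Suc_le_eq)
  then show ?thesis using False by (simp add: deficit_def)
qed

lemma deficit_d: "deficit v x CARD('n) = 0"
  using S_less by (fastforce simp: deficit_def intro: sum.neutral)

lemma deficit_ge_one:
  assumes "\<And>j. j \<in> S \<Longrightarrow> coord x j \<le> 1" "j \<in> S" "k \<le> j"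
  shows "1 - coord x j \<le> deficit v x k"
  unfolding deficit_def by (rule member_le_sum) (use assms in auto)

lemma deficit_pos_imp: "0 < deficit v x k \<Longrightarrow> \<exists>j\<in>S. k \<le> j \<and> coord x j \<noteq> 1"
  unfolding deficit_def by (rule ccontr) (auto simp: sum.neutral)

section \<open>Completeness by random rounding\<close>

text \<open>
  In both directions the position that decides the comparison is the largest zero of \<open>z\<close> in \<open>S\<close>: the
  inequalities force every coordinate of \<open>z\<close> outside \<open>S\<close> above it to vanish. Indices below \<open>s = min S\<close>
  never lie above that zero.
\<close>

lemma revlex_less_iff_deficit:
  assumes z: "z \<in> zero_one"
  shows "revlex_less z v \<longleftrightarrow>
    1 \<le> deficit v z 0 \<and> (\<forall>i\<in>S_bar v. s < i \<longrightarrow> coord z i \<le> deficit v z (Suc i))"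
proof
  have z01: "coord z i = 0 \<or> coord z i = 1" if "i < CARD('n)" for i using zero_oneD[OF z that] .
  have zS: "coord z j \<le> 1" if "j \<in> S" for j using z01[OF S_less[OF that]] by auto
  {
    assume "revlex_less z v"
    then obtain m where m: "m < CARD('n)" "coord z m < coord v m"
      "\<forall>i. m < i \<and> i < CARD('n) \<longrightarrow> coord z i = coord v i"
      unfolding revlex_less_iff by blast
    have mS: "m \<in> S" "coord z m = 0" using m z01[of m] coord_v[of m] by (auto split: if_splits)
    have deficit: "1 \<le> deficit v z k" if "k \<le> m" for k using deficit_ge_one[OF zS mS(1) that] mS(2) by simp
    show "1 \<le> deficit v z 0 \<and> (\<forall>i\<in>S_bar v. s < i \<longrightarrow> coord z i \<le> deficit v z (Suc i))"
    proof (intro conjI ballI impI)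
      show "1 \<le> deficit v z 0" using deficit by simp
      fix i assume "i \<in> S_bar v"
      then have i: "i < CARD('n)" "i \<notin> S" by (auto simp: S_bar_def)
      show "coord z i \<le> deficit v z (Suc i)"
      proof (cases "i < m")
        case True
        then show ?thesis using deficit[of "Suc i"] z01[OF i(1)] by auto
      next
        case False
        then have "coord z i = 0" using i m(3) mS(1) coord_v[of i] by (metis linorder_neqE_nat)
        then show ?thesis using zS by (auto simp: deficit_def intro: sum_nonneg)
      qed
    qed
  next
    assume A: "1 \<le> deficit v z 0 \<and> (\<forall>i\<in>S_bar v. s < i \<longrightarrow> coord z i \<le> deficit v z (Suc i))"
    define Z where "Z = {j \<in> S. coord z j \<noteq> 1}"
    define m where "m = Max Z"
    have "Z \<noteq> {}" using A deficit_pos_imp[of z 0] by (auto simp: Z_def)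
    then have "m \<in> Z" unfolding m_def by (intro Max_in) (auto simp: Z_def)
    then have m: "m \<in> S" "m < CARD('n)" "coord z m = 0" using z01 S_less by (auto simp: Z_def)
    have above: "coord z j = 1" if "j \<in> S" "m < j" for j
      using that Max_ge[of Z j] unfolding m_def Z_def by fastforce
    have "coord z i = coord v i" if i: "m < i" "i < CARD('n)" for i
    proof (cases "i \<in> S")
      case True
      then show ?thesis using above i coord_v by simp
    next
      case False
      then have "coord z i \<le> deficit v z (Suc i)"
        using A i s_is_least(2)[OF m(1)] by (auto simp: S_bar_def)
      moreover have "deficit v z (Suc i) = 0"
        unfolding deficit_def using above i by (intro sum.neutral) auto
      ultimately show ?thesis using z01[OF i(2)] False coord_v[OF i(2)] by auto
    qed
    then show "revlex_less z v"
      unfolding revlex_less_iff using m coord_v by (intro exI[of _ m]) auto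
  }
qed

text \<open>
  Inequalities in only two variables make the bounds for indices in \<open>D(v)\<close> redundant. If
  \<open>w(v) = 2\<close>, the inequality excluding \<open>v\<close> reads \<open>x\<^sub>t + x\<^bsub>d-1\<^esub> \<le> 1\<close>. For \<open>t < k < d - 1\<close>, the only element of
  \<open>S\<close> above \<open>k\<close> is \<open>d - 1\<close>, so the inequality attached to \<open>k\<close> reads \<open>x\<^sub>k + x\<^bsub>d-1\<^esub> \<le> 1\<close>; the bound on
  \<open>x\<^bsub>d-1\<^esub>\<close> itself needs such a \<open>k\<close>, which exists when \<open>t < d - 2\<close>.
\<close>

lemma slack_imp_le_1:
  assumes x: "\<forall>q\<in>ineqs v. 0 \<le> slack v q x" and i: "i < CARD('n)"
  shows "coord x i \<le> 1"
proof (cases "i \<in> D_set v")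
  case False
  then have "Upper i \<in> ineqs v" using i by (simp add: ineqs_def)
  then show ?thesis using x by fastforce
next
  case True
  have nonneg: "0 \<le> coord x j" if "j < CARD('n)" for j
  proof -
    have "Lower j \<in> ineqs v" using that by (simp add: ineqs_def)
    then show ?thesis using x by fastforce
  qed
  have cover: "1 \<le> deficit v x 0" using x by (auto simp: ineqs_def)
  have lifted: "coord x k + coord x (CARD('n) - 1) \<le> 1" if "t < k" "k < CARD('n) - 1" for k
  proof -
    have "k \<notin> S" using that t_is_second_largest(3) by fastforce
    then have "Lifted k \<in> ineqs v" using that s_le_t by (auto simp: ineqs_def S_bar_def)
    then have "coord x k \<le> deficit v x (Suc k)" using x by fastforce
    moreover have "{j \<in> S. Suc k \<le> j} = {CARD('n) - 1}"
      using that t_is_second_largest(3) top_and_second(1) by fastforce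
    ultimately show ?thesis by (simp add: deficit_def)
  qed
  consider "weight v = 2" "i \<in> S" | "t < CARD('n) - 2" "t < i"
    using True by (auto simp: D_set_def D1_def D2_def split: if_splits)
  then show ?thesis
  proof cases
    case 1
    have "{j \<in> S. 0 \<le> j} = {t, CARD('n) - 1}" using weight_2_imp[OF 1(1)] by auto
    then have "deficit v x 0 = (1 - coord x t) + (1 - coord x (CARD('n) - 1))"
      using t_is_second_largest(2) by (simp only: deficit_def) simp
    then have "coord x t + coord x (CARD('n) - 1) \<le> 1" using cover by simp
    moreover have "i = t \<or> i = CARD('n) - 1" using 1(2) t_is_second_largest(3) weight_2_imp[OF 1(1)] by blast
    ultimately show ?thesis using nonneg[OF S_less, of t] nonneg[OF S_less, of "CARD('n) - 1"]
        t_is_second_largest(1) top_and_second(1) by auto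
  next
    case 2
    show ?thesis
    proof (cases "i = CARD('n) - 1")
      case True
      have "Suc t < CARD('n) - 1" using 2(1) by linarith
      then have "coord x (Suc t) + coord x i \<le> 1" "0 \<le> coord x (Suc t)"
        using lifted[of "Suc t"] nonneg[of "Suc t"] True by auto
      then show ?thesis by linarith
    next
      case False
      then have "i < CARD('n) - 1" using i by linarith
      then have "coord x i + coord x (CARD('n) - 1) \<le> 1" "0 \<le> coord x (CARD('n) - 1)"
        using lifted[of i] nonneg[of "CARD('n) - 1"] 2(2) by auto
      then show ?thesis by linarith
    qed
  qed
qed

text \<open>
  The coordinates in \<open>S\<close> are chosen so that the deficits of the rounded point are the rounded
  deficits of \<open>x\<close>. Geometrically, intervals of length \<open>1 - x\<^sub>j\<close> for \<open>j \<in> S\<close> are wound consecutively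
  around a circle of length one, largest \<open>j\<close> first, and the zeros are the \<open>j\<close> whose interval contains
  \<open>\<theta>\<close>.
\<close>

definition rounding :: "real ^ 'n::{finite,linorder} \<Rightarrow> real \<Rightarrow> real ^ 'n::{finite,linorder}" where
  "rounding x \<theta> = vec_of (\<lambda>i. if i \<in> S
     then 1 - (real_of_int \<lceil>deficit v x i - \<theta>\<rceil> - real_of_int \<lceil>deficit v x (Suc i) - \<theta>\<rceil>)
     else real_of_int \<lceil>coord x i - \<theta>\<rceil>)"

text \<open>The sum telescopes; nothing remains at the upper end since \<open>\<lceil>0 - \<theta>\<rceil> = 0\<close> for \<open>0 \<le> \<theta> < 1\<close>.\<close>

lemma deficit_rounding:
  assumes "0 \<le> \<theta>" "\<theta> < 1" "k \<le> CARD('n)"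
  shows "deficit v (rounding x \<theta>) k = \<lceil>deficit v x k - \<theta>\<rceil>"
  using \<open>k \<le> CARD('n)\<close>
proof (induction rule: inc_induct)
  case base
  have "\<lceil>- \<theta>\<rceil> = 0" using assms(1,2) by (simp add: ceiling_eq_iff)
  then show ?case by (simp add: deficit_d)
next
  case (step k)
  then show ?case
    using deficit_Suc[of "rounding x \<theta>" k] deficit_Suc[of x k] by (simp add: rounding_def)
qed

text \<open>
  Both kinds of inequality compare a coordinate or a constant with one deficit, and
  \<open>c \<mapsto> \<lceil>c - \<theta>\<rceil>\<close> is monotone, so they survive the rounding.
\<close>

lemma rounding_in_revlex_initial:
  assumes x: "\<forall>q\<in>ineqs v. 0 \<le> slack v q x" and \<theta>: "0 \<le> \<theta>" "\<theta> < 1"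
  shows "rounding x \<theta> \<in> revlex_initial v"
proof -
  have ge0: "0 \<le> coord x j" if "j < CARD('n)" for j
  proof -
    have "Lower j \<in> ineqs v" using that by (simp add: ineqs_def)
    then show ?thesis using x by fastforce
  qed
  have le1: "coord x j \<le> 1" if "j < CARD('n)" for j using slack_imp_le_1[OF x that] .
  have "coord (rounding x \<theta>) i \<in> {0, 1}" if i: "i < CARD('n)" for i
  proof (cases "i \<in> S")
    case True
    then have "deficit v x i = 1 - coord x i + deficit v x (Suc i)" using deficit_Suc[of x i] by simp
    then have "\<lceil>deficit v x i - \<theta>\<rceil> = \<lceil>deficit v x (Suc i) - \<theta>\<rceil> \<or>
        \<lceil>deficit v x i - \<theta>\<rceil> = \<lceil>deficit v x (Suc i) - \<theta>\<rceil> + 1"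
      using ge0[OF i] le1[OF i] by linarith
    then show ?thesis using True i by (auto simp: rounding_def)
  next
    case False
    have "\<lceil>coord x i - \<theta>\<rceil> = 0 \<or> \<lceil>coord x i - \<theta>\<rceil> = 1"
      using ge0[OF i] le1[OF i] \<theta> by linarith
    then show ?thesis using False i by (auto simp: rounding_def)
  qed
  then have z01: "rounding x \<theta> \<in> zero_one" by (simp add: zero_one_def)
  have "1 \<le> deficit v (rounding x \<theta>) 0"
  proof -
    have "1 \<le> deficit v x 0" using x by (auto simp: ineqs_def)
    then have "1 \<le> \<lceil>deficit v x 0 - \<theta>\<rceil>" using \<theta> by linarith
    then show ?thesis using deficit_rounding[OF \<theta>, of 0 x] by simp
  qed
  moreover have "coord (rounding x \<theta>) i \<le> deficit v (rounding x \<theta>) (Suc i)"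
    if "i \<in> S_bar v" "s < i" for i
  proof -
    have i: "i < CARD('n)" "i \<notin> S" using that by (auto simp: S_bar_def)
    have "Lifted i \<in> ineqs v" using that by (simp add: ineqs_def)
    then have "coord x i \<le> deficit v x (Suc i)" using x by fastforce
    then have "\<lceil>coord x i - \<theta>\<rceil> \<le> \<lceil>deficit v x (Suc i) - \<theta>\<rceil>" by (intro ceiling_mono) simp
    then show ?thesis using deficit_rounding[OF \<theta>, of "Suc i" x] i by (simp add: rounding_def)
  qed
  ultimately have "revlex_less (rounding x \<theta>) v"
    using revlex_less_iff_deficit[OF z01] by blast
  then show ?thesis using z01 by (simp add: revlex_initial_def)
qed

lemma rounding_has_mean: "((\<lambda>\<theta>. a \<bullet> rounding x \<theta>) has_integral a \<bullet> x) {0..1}"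
  unfolding inner_eq_sum_coord
proof (intro has_integral_sum finite_lessThan has_integral_mult_right)
  fix i assume "i \<in> {..<CARD('n)}"
  then have i: "i < CARD('n)" by simp
  show "((\<lambda>\<theta>. coord (rounding x \<theta>) i) has_integral coord x i) {0..1}"
  proof (cases "i \<in> S")
    case True
    have "((\<lambda>\<theta>. 1 - (real_of_int \<lceil>deficit v x i - \<theta>\<rceil> - real_of_int \<lceil>deficit v x (Suc i) - \<theta>\<rceil>))
        has_integral 1 - (deficit v x i - deficit v x (Suc i))) {0..1}"
      using has_integral_const_real[of "1::real" 0 1]
      by (intro has_integral_diff ceiling_shift_has_integral) simp
    then show ?thesis using True i deficit_Suc[of x i] by (simp add: rounding_def)
  next
    case False
    then show ?thesis using i ceiling_shift_has_integral[of "coord x i"]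
      by (simp add: rounding_def)
  qed
qed

lemma finite_revlex_initial: "finite (revlex_initial v)"
proof (rule finite_subset)
  show "revlex_initial v \<subseteq> (\<lambda>A. vec_of (indicator A)) ` Pow {..<CARD('n)}"
  proof
    fix x assume "x \<in> revlex_initial v"
    then have x: "x \<in> zero_one" by (simp add: revlex_initial_def)
    have "x = vec_of (indicator {i. i < CARD('n) \<and> coord x i = 1})"
      by (rule vec_eq_coordI) (use zero_oneD[OF x] in \<open>force simp: indicator_def\<close>)
    then show "x \<in> (\<lambda>A. vec_of (indicator A)) ` Pow {..<CARD('n)}" by blast
  qed
qed simp

lemma solutions_eq: "solutions (revlex_system v) = revlex_polytope v"
proof
  show "revlex_polytope v \<subseteq> solutions (revlex_system v)"
    unfolding revlex_polytope_def
  proof (rule hull_minimal)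
    have "solutions (revlex_system v) = (\<Inter>q\<in>ineqs v. {x. normal v q \<bullet> x \<le> rhs v q})"
      by (auto simp: solutions_def revlex_system_eq)
    then show "convex (solutions (revlex_system v))"
      by (auto intro: convex_INT convex_halfspace_le)
    show "revlex_initial v \<subseteq> solutions (revlex_system v)"
    proof
      fix z assume "z \<in> revlex_initial v"
      then have z: "z \<in> zero_one" "revlex_less z v" by (auto simp: revlex_initial_def)
      show "z \<in> solutions (revlex_system v)"
        unfolding in_solutions_iff ineqs_def
        using zero_oneD[OF z(1)] revlex_less_iff_deficit[OF z(1)] z(2) by fastforce
    qed
  qed
  show "solutions (revlex_system v) \<subseteq> revlex_polytope v"
  proof
    fix x assume "x \<in> solutions (revlex_system v)"
    then have x: "\<forall>q\<in>ineqs v. 0 \<le> slack v q x" by (simp add: in_solutions_iff)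
    show "x \<in> revlex_polytope v"
      unfolding revlex_polytope_def
    proof (rule mean_in_closed_convex)
      show "closed (convex hull revlex_initial v)"
        using finite_revlex_initial
        by (intro compact_imp_closed compact_convex_hull finite_imp_compact)
      show "rounding x \<theta> \<in> convex hull revlex_initial v" if "0 \<le> \<theta>" "\<theta> < 1" for \<theta>
        using rounding_in_revlex_initial[OF x that] by (rule hull_inc)
    qed (use rounding_has_mean in auto)
  qed
qed

section \<open>Irredundancy and facets\<close>

lemma deficit_const:
  "deficit v (vec_of (\<lambda>_. c)) k = (1 - c) * card {j \<in> S. k \<le> j}"
  using S_less by (simp add: deficit_def)

lemma deficit_scaled_unit_vec:
  fixes c :: real
  assumes "i < CARD('n)"
  shows "deficit v (c *\<^sub>R unit_vec i) k = card {j \<in> S. k \<le> j} - (if i \<in> S \<and> k \<le> i then c else 0)"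
proof -
  have "deficit v (c *\<^sub>R unit_vec i) k = (\<Sum>j\<in>{j \<in> S. k \<le> j}. 1 - (if j = i then c else 0))"
    unfolding deficit_def using S_less assms by (intro sum.cong) auto
  then show ?thesis by (simp add: sum_subtractf)
qed

lemma card_S_from_ge_1:
  assumes "k < CARD('n)"
  shows "1 \<le> real (card {j \<in> S. k \<le> j})"
proof -
  have "card {CARD('n) - 1} \<le> card {j \<in> S. k \<le> j}"
    by (rule card_mono) (use assms top_and_second(1) in auto)
  then show ?thesis by simp
qed

lemma card_S_from_ge_2:
  assumes "i \<in> S" "i < CARD('n) - 1" "k \<le> i"
  shows "2 \<le> real (card {j \<in> S. k \<le> j})"
proof -
  have "card {i, CARD('n) - 1} \<le> card {j \<in> S. k \<le> j}"
    by (rule card_mono) (use assms top_and_second(1) in auto)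
  then show ?thesis using assms(2) by simp
qed

text \<open>
  Each inequality is violated by its own normal vector, with a factor 2 for the upper bounds, where the
  unit vector itself still satisfies the inequality.
\<close>

fun witness :: "ineq \<Rightarrow> real ^ 'n::{finite,linorder}" where
  "witness (Lower i) = (- 1) *\<^sub>R unit_vec i"
| "witness (Upper i) = 2 *\<^sub>R unit_vec i"
| "witness (Lifted i) = vec_of (indicator (insert i (S_above i v)))"
| "witness Cover = v"

lemma ineq_cases:
  assumes "q \<in> ineqs v"
  obtains (Lower) i where "q = Lower i" "i < CARD('n)"
  | (Upper) i where "q = Upper i" "i < CARD('n)" "i \<notin> D_set v"
  | (Lifted) i where "q = Lifted i" "i < CARD('n) - 1" "i \<notin> S" "s < i"
  | (Cover) "q = Cover"
proof -
  have "i < CARD('n) - 1" if "i \<in> S_bar v" for i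
    using that top_and_second(1) by (cases "i = CARD('n) - 1") (auto simp: S_bar_def)
  then show ?thesis using assms that by (fastforce simp: ineqs_def S_bar_def)
qed

text \<open>
  What it means for an index to keep its upper bound, in the form in which it is needed to see that
  \<open>2 e\<^sub>i\<close> violates nothing else: enough elements of \<open>S\<close> remain to absorb the coordinate 2.
\<close>

lemma not_in_D_cases:
  assumes "i < CARD('n)" "i \<notin> D_set v"
  obtains "i \<in> S" "3 \<le> weight v" "i < CARD('n) - 1"
  | "i = CARD('n) - 1" "3 \<le> weight v" "t = CARD('n) - 2"
  | "i \<notin> S" "i < t"
proof (cases "i \<in> S")
  case True
  then have "weight v \<noteq> 2" using assms(2) by (auto simp: D_set_def D1_def)
  then have "3 \<le> weight v" using weight_ge_2 by simp
  moreover have "t = CARD('n) - 2" if "i = CARD('n) - 1"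
    using assms(2) that t_is_second_largest(2) by (auto simp: D_set_def D2_def split: if_splits)
  ultimately show ?thesis using that True assms(1) by (cases "i = CARD('n) - 1") auto
next
  case False
  have "i \<noteq> t" "i \<noteq> CARD('n) - 1" using False t_is_second_largest(1) top_and_second(1) by auto
  then have "i < t"
    using assms t_is_second_largest(2) by (auto simp: D_set_def D2_def split: if_splits)
  then show ?thesis using that False by blast
qed

text \<open>
  The delicate witness is \<open>2 e\<^sub>i\<close>. It lowers the deficits from \<open>i\<close> downwards by 2 if \<open>i \<in> S\<close> and raises
  the left-hand side of its own lifted inequality to 2 otherwise; in both cases at least two elements of
  \<open>S\<close> above the index of each affected lifted inequality are needed, and three elements in \<open>S\<close> for the
  inequality excluding \<open>v\<close> if \<open>i \<in> S\<close>. This is where \<open>i \<notin> D(v)\<close> enters.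
\<close>

lemma slack_witness:
  assumes q: "q \<in> ineqs v" and p: "p \<in> ineqs v" "p \<noteq> q"
  shows "0 \<le> slack v p (witness q)"
  using q
proof (cases rule: ineq_cases)
  case (Lower i)
  have deficit: "1 \<le> deficit v (witness q) k" if "k < CARD('n)" for k
    using card_S_from_ge_1[OF that] deficit_scaled_unit_vec[of i "- 1" k] Lower by simp
  show ?thesis
    using p(1)
  proof (cases rule: ineq_cases)
    case (Lifted k)
    then have "1 \<le> deficit v (witness q) (Suc k)" "coord (witness q) k \<le> 0"
      using deficit[of "Suc k"] Lower by simp_all
    then show ?thesis using Lifted by simp
  next
    case Cover
    then show ?thesis using deficit[of 0] by simp
  qed (use Lower p(2) in auto)
next
  case (Upper i)
  show ?thesis
    using p(1)
  proof (cases rule: ineq_cases)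
    case Cover
    then show ?thesis
      using Upper weight_ge_2
      by (cases rule: not_in_D_cases[OF Upper(2,3)])
        (auto simp: deficit_scaled_unit_vec weight_def)
  next
    case (Lifted k)
    have "2 \<le> real (card {j \<in> S. Suc k \<le> j})" if "k \<le> i" "k = i \<or> i \<in> S"
      using Upper(2,3)
    proof (cases rule: not_in_D_cases)
      case 1
      then show ?thesis using that Lifted(3) card_S_from_ge_2[of i "Suc k"] by (cases "k = i") auto
    next
      case 2
      then have "k < t" using Lifted t_is_second_largest(1) by (cases "k = t") auto
      then show ?thesis using card_S_from_ge_2[OF t_is_second_largest(1,2)] by simp
    next
      case 3
      then show ?thesis using that card_S_from_ge_2[OF t_is_second_largest(1,2)] by simp
    qed
    then show ?thesis using Upper Lifted by (auto simp: deficit_scaled_unit_vec)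
  qed (use Upper p(2) in auto)
next
  case (Lifted i)
  have le1: "coord (witness q) j \<le> 1" if "j < CARD('n)" for j
    using that Lifted by (simp add: indicator_def)
  have deficit0: "0 \<le> deficit v (witness q) k" for k
    unfolding deficit_def using le1 S_less by (intro sum_nonneg) simp
  show ?thesis
    using p(1)
  proof (cases rule: ineq_cases)
    case Cover
    have "coord (witness q) s = 0"
      using Lifted s_is_least(1) S_less by (simp add: S_above_def)
    then have "1 \<le> deficit v (witness q) 0"
      using deficit_ge_one[OF le1[OF S_less] s_is_least(1), of 0] by simp
    then show ?thesis using Cover by simp
  next
    case (Lifted k)
    then have "coord (witness q) k = 0"
      using p(2) \<open>q = Lifted i\<close> by (simp add: S_above_def)
    then show ?thesis using Lifted deficit0 by simp
  qed (use Lifted le1 in \<open>auto simp: indicator_def\<close>)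
next
  case Cover
  have deficit: "deficit v (witness q) k = 0" for k
    unfolding deficit_def using S_less coord_v Cover by (intro sum.neutral) auto
  show ?thesis
    using p(1)
  proof (cases rule: ineq_cases)
    case (Lifted k)
    then have "coord (witness q) k = 0" using coord_v Cover by simp
    then show ?thesis using Lifted deficit by simp
  qed (use Cover p(2) coord_v in auto)
qed

lemma slack_witness_neg:
  assumes "q \<in> ineqs v"
  shows "slack v q (witness q) < 0"
  using assms
proof (cases rule: ineq_cases)
  case (Lifted i)
  have "deficit v (witness q) (Suc i) = 0"
    unfolding deficit_def using S_less Lifted by (intro sum.neutral) (auto simp: S_above_def)
  then show ?thesis using Lifted by simp
next
  case Cover
  have "deficit v v 0 = 0"
    unfolding deficit_def using S_less coord_v by (intro sum.neutral) auto
  then show ?thesis using Cover by simp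
qed auto

text \<open>
  At the constant point 1/3 a lifted inequality compares 1/3 with a deficit of at least 2/3, because
  \<open>d - 1 \<in> S\<close>, and the deficit in the inequality excluding \<open>v\<close> is at least 4/3, because \<open>w(v) \<ge> 2\<close>.
\<close>

lemma slack_interior:
  assumes "q \<in> ineqs v"
  shows "0 < slack v q (vec_of (\<lambda>_. 1 / 3))"
  using assms
proof (cases rule: ineq_cases)
  case (Lifted i)
  then have "1 \<le> real (card {j \<in> S. Suc i \<le> j})" by (intro card_S_from_ge_1) simp
  then have "1 / 3 < 2 / 3 * real (card {j \<in> S. Suc i \<le> j})" by linarith
  then show ?thesis using Lifted by (simp add: deficit_const)
next
  case Cover
  then show ?thesis using weight_ge_2 by (simp add: deficit_const weight_def)
qed auto

lemma finite_ineqs: "finite (ineqs v)"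
  by (simp add: ineqs_def S_bar_def)

lemma dim_minimality_facets:
  shows "aff_dim (revlex_polytope v) = CARD('n)"
    and "minimal_description (revlex_system v) (revlex_polytope v)"
    and "\<forall>q\<in>revlex_system v. facet_defining q (revlex_polytope v)"
    and "num_facets (revlex_polytope v) = card (ineqs v)"
proof -
  have y: "normal v q \<bullet> vec_of (\<lambda>_. 1 / 3) < rhs v q" if "q \<in> ineqs v" for q
    using slack_interior[OF that] by (simp add: slack_eq)
  have z: "rhs v q < normal v q \<bullet> witness q" if "q \<in> ineqs v" for q
    using slack_witness_neg[OF that] by (simp add: slack_eq)
  have o: "normal v p \<bullet> witness q \<le> rhs v p" if "q \<in> ineqs v" "p \<in> ineqs v" "p \<noteq> q" for p q
    using slack_witness[OF that] by (simp add: slack_eq)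
  note system = irredundant_system[where a = "normal v" and b = "rhs v" and I = "ineqs v"
      and z = witness, OF finite_ineqs y z o, folded revlex_system_eq, unfolded solutions_eq]
  show "aff_dim (revlex_polytope v) = CARD('n)" using system(1) by simp
  show "minimal_description (revlex_system v) (revlex_polytope v)"
    "\<forall>q\<in>revlex_system v. facet_defining q (revlex_polytope v)"
    "num_facets (revlex_polytope v) = card (ineqs v)"
    using system(2-4) by simp_all
qed

section \<open>Counting the facets\<close>

abbreviation "gaps \<equiv> {i. s < i \<and> i < t \<and> coord v i = 0}"

lemma weight_2_iff: "weight v = 2 \<longleftrightarrow> s = t"
proof
  assume "weight v = 2"
  then have "s = t \<or> s = CARD('n) - 1" using s_is_least(1) weight_2_imp by blast
  then show "s = t" using s_le_t t_is_second_largest(2) by linarith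
next
  assume "s = t"
  then have "j = t \<or> j = CARD('n) - 1" if "j \<in> S" for j
    using s_is_least(2)[OF that] t_is_second_largest(3)[OF that] by linarith
  then have "S = {t, CARD('n) - 1}" using t_is_second_largest(1) top_and_second(1) by blast
  then show "weight v = 2" using t_is_second_largest(2) by (simp add: weight_def)
qed

lemma coord_below_top: "coord v (CARD('n) - 2) = 0 \<longleftrightarrow> t < CARD('n) - 2"
proof (cases "t = CARD('n) - 2")
  case True
  then show ?thesis using t_is_second_largest(1) coord_v[of t] S_less[of t] by simp
next
  case False
  then have "t < CARD('n) - 2" using t_is_second_largest(2) by simp
  moreover from this have "CARD('n) - 2 \<notin> S"
    using t_is_second_largest(3)[of "CARD('n) - 2"] by auto
  ultimately show ?thesis using coord_v[of "CARD('n) - 2"] by simp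
qed

lemma card_ineqs:
  "card (ineqs v) + card (D_set v) = 2 * CARD('n) + card {i \<in> S_bar v. s < i} + 1"
proof -
  have D: "D_set v \<subseteq> {..<CARD('n)}"
    using S_less by (auto simp: D_set_def D1_def D2_def)
  have fin: "finite {i \<in> S_bar v. s < i}" by (simp add: S_bar_def)
  have "card (ineqs v) = card (Lower ` {..<CARD('n)}) + card (Upper ` ({..<CARD('n)} - D_set v)) +
      card (Lifted ` {i \<in> S_bar v. s < i}) + card {Cover}"
  proof -
    have card_Un4: "card (A \<union> B \<union> C \<union> E) = card A + card B + card C + card E"
      if "finite A" "finite B" "finite C" "finite E"
        "A \<inter> B = {}" "(A \<union> B) \<inter> C = {}" "(A \<union> B \<union> C) \<inter> E = {}" for A B C E :: "ineq set"
      using that by (simp only: card_Un_disjoint finite_Un simp_thms)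
    show ?thesis unfolding ineqs_def by (rule card_Un4) (use fin in auto)
  qed
  then have "card (ineqs v) = CARD('n) + (CARD('n) - card (D_set v)) +
      card {i \<in> S_bar v. s < i} + 1"
    using D by (simp add: card_image inj_on_def card_Diff_subset finite_subset)
  moreover have "card (D_set v) \<le> CARD('n)" using card_mono[OF _ D] by simp
  ultimately show ?thesis by simp
qed

text \<open>
  The \<open>d - 2 - t\<close> lifted inequalities with \<open>i\<close> between \<open>t\<close> and \<open>d - 1\<close> are one fewer than the upper
  bounds that \<open>D\<^sub>2(v)\<close> removes, whenever it removes any. They cancel, and only the gaps below \<open>t\<close> and
  the correction \<open>eps\<close> remain in the number of facets.
\<close>

lemma card_lifted: "card {i \<in> S_bar v. s < i} = card gaps + (CARD('n) - 2 - t)"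
proof -
  have bar: "i \<in> S_bar v \<longleftrightarrow> i < CARD('n) \<and> coord v i = 0" for i
    using coord_v by (auto simp: S_bar_def split: if_splits)
  have "{i \<in> S_bar v. s < i} = gaps \<union> {t<..<CARD('n) - 1}"
  proof (rule set_eqI)
    fix i
    consider "i < t" | "i = t" | "t < i" "i < CARD('n) - 1" | "i = CARD('n) - 1" | "i \<ge> CARD('n)"
      by linarith
    then show "i \<in> {i \<in> S_bar v. s < i} \<longleftrightarrow> i \<in> gaps \<union> {t<..<CARD('n) - 1}"
    proof cases
      case 3
      then have "i \<notin> S" using t_is_second_largest(3)[of i] by auto
      then show ?thesis using 3 s_le_t coord_v[of i] by (simp add: bar)
    qed (use t_is_second_largest(1,2) top_and_second(1) in \<open>auto simp: bar S_set_def\<close>)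
  qed
  moreover have "card (gaps \<union> {t<..<CARD('n) - 1}) = card gaps + card {t<..<CARD('n) - 1}"
    by (rule card_Un_disjoint) auto
  ultimately have "card {i \<in> S_bar v. s < i} = card gaps + card {t<..<CARD('n) - 1}"
    by (simp only:)
  then show ?thesis by (simp only: card_greaterThanLessThan)
qed

lemma card_D: "int (card (D_set v)) = int (CARD('n) - 2 - t) + 1 - eps v"
proof -
  show ?thesis
  proof (cases "weight v = 2")
    case True
    have "D_set v = {t, CARD('n) - 1} \<union> D2 v"
      using True weight_2_imp[OF True] by (simp add: D_set_def D1_def)
    also have "\<dots> = insert t {t + 1..CARD('n) - 1}"
      using t_is_second_largest(2) unfolding D2_def by auto
    finally have "card (D_set v) = CARD('n) - t" using t_is_second_largest(2) by simp
    then show ?thesis using True t_is_second_largest(2) by (simp add: eps_def)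
  next
    case False
    then have "D_set v = D2 v" by (simp add: D_set_def D1_def)
    moreover have "card (D2 v) = (if t < CARD('n) - 2 then CARD('n) - 1 - t else 0)"
      by (simp add: D2_def)
    moreover have "eps v = (if t < CARD('n) - 2 then 0 else 1)"
      using False coord_below_top by (simp only: eps_def if_False)
    ultimately show ?thesis using t_is_second_largest(2) by (cases "t < CARD('n) - 2"; simp; linarith)
  qed
qed

lemma num_facets_eq: "int (num_facets (revlex_polytope v)) = 2 * CARD('n) + card gaps + eps v"
  using card_ineqs card_lifted card_D by (simp add: dim_minimality_facets(4))

text \<open>
  This limits the number of facets: \<open>t \<le> d - 2\<close> and \<open>s \<ge> 0\<close> leave at most \<open>d - 3\<close> gaps, and that many
  only if \<open>t = d - 2\<close>, \<open>s = 0\<close> and \<open>v\<close> vanishes at all positions in between.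
\<close>

lemma card_gaps: "s < t \<Longrightarrow> s + card gaps < t"
proof -
  assume "s < t"
  have "card gaps \<le> card {s<..<t}" by (rule card_mono) auto
  then have "card gaps \<le> t - Suc s" by (simp only: card_greaterThanLessThan)
  then show ?thesis using \<open>s < t\<close> by linarith
qed

lemma gaps_eps_cases:
  obtains "weight v = 2" "card gaps = 0" "eps v = - 1"
  | "s < t" "weight v \<noteq> 2" "t < CARD('n) - 2" "eps v = 0"
  | "s < t" "weight v \<noteq> 2" "t = CARD('n) - 2" "eps v = 1"
proof (cases "weight v = 2")
  case True
  then have "s = t" by (simp only: weight_2_iff)
  then have "gaps = {}" by simp
  then have "card gaps = 0" by (simp only: card.empty)
  moreover have "eps v = - 1" using True by (simp add: eps_def)
  ultimately show ?thesis using that(1) True by blast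
next
  case False
  moreover from this have "s < t" using weight_2_iff s_le_t by simp
  moreover have "t < CARD('n) - 2 \<or> t = CARD('n) - 2" using t_is_second_largest(2) by linarith
  moreover have "eps v = (if t < CARD('n) - 2 then 0 else 1)"
    using False coord_below_top by (simp only: eps_def if_False)
  ultimately show ?thesis using that(2,3) by fastforce
qed

lemma max_facets_iff:
  assumes d: "3 \<le> CARD('n)"
  shows "card gaps + eps v = int CARD('n) - 2 \<longleftrightarrow>
    v = unit_vec 0 + unit_vec (CARD('n) - 2) + unit_vec (CARD('n) - 1)" (is "_ \<longleftrightarrow> v = ?u")
proof
  assume eq: "card gaps + eps v = int CARD('n) - 2"
  have st: "s < t \<and> t = CARD('n) - 2 \<and> eps v = 1"
  proof (cases rule: gaps_eps_cases)
    case 1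
    then show ?thesis using eq d by linarith
  next
    case 2
    then show ?thesis using eq d card_gaps by linarith
  qed blast
  then have s0: "s = 0" using eq card_gaps d by linarith
  have gaps_eq: "gaps = {0<..<t}"
  proof (rule card_subset_eq)
    show "gaps \<subseteq> {0<..<t}" by auto
    have "card gaps = t - Suc 0" using eq st d by linarith
    then show "card gaps = card {0<..<t}" by (simp only: card_greaterThanLessThan)
  qed simp
  have zero: "coord v i = 0" if "0 < i" "i < t" for i
  proof -
    have "i \<in> gaps" unfolding gaps_eq using that by simp
    then show ?thesis by (rule CollectE) blast
  qed
  have "coord v i = coord ?u i" if i: "i < CARD('n)" for i
  proof -
    have one: "coord v j = 1" if "j \<in> S" for j using that by (simp add: S_set_def)
    have t: "t = CARD('n) - 2" using st by blast
    consider "i = 0" | "0 < i" "i < t" | "i = CARD('n) - 2" | "i = CARD('n) - 1"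
      using i t by linarith
    then show ?thesis
    proof cases
      case 1
      then show ?thesis using one[OF s_is_least(1)] d by (simp add: s0)
    next
      case 2
      then show ?thesis using zero[OF 2] d t by simp
    next
      case 3
      then show ?thesis using one[OF t_is_second_largest(1)] d by (simp add: t)
    next
      case 4
      then show ?thesis using one[OF top_and_second(1)] d by simp
    qed
  qed
  then show "v = ?u" by (rule vec_eq_coordI)
next
  assume u: "v = ?u"
  have coord: "coord v i = (if i = 0 \<or> i = CARD('n) - 2 \<or> i = CARD('n) - 1 then 1 else 0)"
    if "i < CARD('n)" for i
    by (subst u) (use that d in auto)
  have S: "i \<in> S \<longleftrightarrow> i = 0 \<or> i = CARD('n) - 2 \<or> i = CARD('n) - 1" for i
    using coord[of i] d unfolding S_set_def by (auto split: if_splits)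
  have t: "t = CARD('n) - 2" using t_is_second_largest(2) t_is_second_largest(3)[of "CARD('n) - 2"] d S by auto
  have s: "s = 0" using s_is_least(2)[of 0] S by simp
  have "i \<in> gaps \<longleftrightarrow> i \<in> {0<..<t}" for i
    using coord[of i] d unfolding s t by auto
  then have "gaps = {0<..<t}" by (rule set_eqI)
  then have "card gaps = t - Suc 0" by (simp only: card_greaterThanLessThan)
  moreover have "eps v = 1"
  proof -
    have "weight v \<noteq> 2" unfolding weight_2_iff s t using d by simp
    moreover have "coord v (CARD('n) - 2) \<noteq> 0" unfolding coord_below_top t by simp
    ultimately show ?thesis by (simp add: eps_def)
  qed
  ultimately show "card gaps + eps v = int CARD('n) - 2" unfolding t using d by linarith
qed

end

theorem theorem2:
  fixes d :: nat and v :: "real ^ 'n::{finite,linorder}"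
  assumes "d = CARD('n)"
    and "v \<in> zero_one"
    and "revlex_less (unit_vec (d - 1)) v"
  shows "aff_dim (revlex_polytope v) = int d \<and>
    minimal_description (revlex_system v) (revlex_polytope v) \<and>
    (\<forall>q \<in> revlex_system v. facet_defining q (revlex_polytope v)) \<and>
    int (num_facets (revlex_polytope v)) =
      2 * int d + int (card {i. sigma_S (weight v) v < i \<and> i < sigma_S 2 v \<and> coord v i = 0}) + eps v \<and>
    2 * int d - 1 \<le> int (num_facets (revlex_polytope v)) \<and>
    int (num_facets (revlex_polytope v)) \<le> 3 * int d - 2 \<and>
    (int (num_facets (revlex_polytope v)) = 2 * int d - 1 \<longleftrightarrow> weight v = 2) \<and>
    (d \<ge> 3 \<longrightarrow>
      (int (num_facets (revlex_polytope v)) = 3 * int d - 2 \<longleftrightarrow>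
        v = unit_vec 0 + unit_vec (d - 2) + unit_vec (d - 1)))"
proof -
  interpret revlex_full v
    using assms by unfold_locales simp_all
  have d: "d = CARD('n)" by fact
  have "- 1 \<le> card gaps + eps v \<and> card gaps + eps v \<le> int d - 2 \<and>
    (card gaps + eps v = - 1 \<longleftrightarrow> weight v = 2)"
  proof (cases rule: gaps_eps_cases)
    case 1
    then show ?thesis using t_is_second_largest(2) d by (simp only: simp_thms) linarith
  next
    case 2
    then have "int (card gaps) < int d - 2" using card_gaps d by linarith
    then show ?thesis using 2(2,4) by auto
  next
    case 3
    then have "int (card gaps) < int d - 2" using card_gaps t_is_second_largest(2) d by linarith
    then show ?thesis using 3(2,4) by auto
  qed
  then have bounds: "- 1 \<le> card gaps + eps v" "card gaps + eps v \<le> int d - 2"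
    "card gaps + eps v = - 1 \<longleftrightarrow> weight v = 2"
    by blast+
  have count: "int (num_facets (revlex_polytope v)) = 2 * int d + int (card gaps) + eps v"
    using num_facets_eq unfolding d by simp
  have min: "int (num_facets (revlex_polytope v)) = 2 * int d - 1 \<longleftrightarrow> weight v = 2"
    unfolding bounds(3)[symmetric] count by linarith
  have max: "int (num_facets (revlex_polytope v)) = 3 * int d - 2 \<longleftrightarrow>
      v = unit_vec 0 + unit_vec (d - 2) + unit_vec (d - 1)" if "d \<ge> 3"
  proof -
    have "int (num_facets (revlex_polytope v)) = 3 * int d - 2 \<longleftrightarrow> card gaps + eps v = int d - 2"
      unfolding count by linarith
    then show ?thesis using max_facets_iff[OF that[unfolded d]] unfolding d by (rule trans)
  qed
  have dim: "aff_dim (revlex_polytope v) = int d" unfolding d by (rule dim_minimality_facets(1))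
  show ?thesis
    by (intro conjI impI dim dim_minimality_facets(2,3) count min max) (use bounds(1,2) count in linarith)+
qed

end
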